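(* Let $c(n)>0$ and $d(n)\ge 1$ (an integer) be functions of $n$ with $c(n)d(n)=o(\log n)$, and let $\epsilon>0$ be any constant. Then for all sufficiently large $n$ (with $c(n)n$ an integer), with probability at least $1-1/n$, the most full bin after all balls have been placed by $\mathrm{GREEDY}(c(n)n,n,d(n))$ has load less than $$\frac{(2+\epsilon)\log n}{\log(2+\epsilon)+\log\log n-\log c(n)-\log d(n)}.$$
   Context: $\mathrm{GREEDY}(m,n,d)$ places $m$ balls into $n$ bins $B_1,\dots,B_n$ over time steps $t=1,\dots,m$. At each time step, $d$ indices are selected from $[n]=\{1,\dots,n\}$ independently and uniformly at random with replacement, forming a multiset $S_t$; the $t$-th ball is placed into a bin $B_M$ with $M\in S_t$ whose current load is maximal among the bins indexed by $S_t$; ties among maximal bins are broken uniformly at random. The load of a bin is the number of balls in it. $\log$ denotes the natural logarithm. *)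

theory Defs
  imports "HOL-Probability.Probability" "HOL-Library.Landau_Symbols" "HOL-Library.Multiset"
begin

text \<open>A state assigns to each bin index its load; bins are indexed by \<open>{1..n}\<close>.\<close>

definition choices :: "nat \<Rightarrow> nat \<Rightarrow> nat multiset pmf" where
  "choices n d = map_pmf mset (replicate_pmf d (pmf_of_set {1..n}))"

text \<open>A tie is broken uniformly among the distinct maximal bins: the multiplicity with which a bin
  was selected does not matter.\<close>

definition fullest :: "(nat \<Rightarrow> nat) \<Rightarrow> nat multiset \<Rightarrow> nat set" where
  "fullest L S = {M. M \<in># S \<and> (\<forall>j\<in>#S. L j \<le> L M)}"

definition greedy_step :: "nat \<Rightarrow> nat \<Rightarrow> (nat \<Rightarrow> nat) \<Rightarrow> (nat \<Rightarrow> nat) pmf" where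
  "greedy_step n d L =
     bind_pmf (choices n d) (\<lambda>S.
     bind_pmf (pmf_of_set (fullest L S)) (\<lambda>M.
     return_pmf (L(M := L M + 1))))"

primrec greedy :: "nat \<Rightarrow> nat \<Rightarrow> nat \<Rightarrow> (nat \<Rightarrow> nat) pmf" where
  "greedy 0 n d = return_pmf (\<lambda>_. 0)"
| "greedy (Suc m) n d = bind_pmf (greedy m n d) (greedy_step n d)"

definition max_load :: "nat \<Rightarrow> (nat \<Rightarrow> nat) \<Rightarrow> nat" where
  "max_load n L = Max (L ` {1..n})"

end

theory Submission
  imports Defs "HOL-Real_Asymp.Real_Asymp"
begin

text \<open>
  A ball lands in a fixed bin only if that bin is among the \<open>d\<close> selected ones, which has probability
  at most \<open>d / n\<close> whatever the history; how the rule then chooses among the selected bins is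
  irrelevant. Hence the moment generating function of the load of a bin is dominated by that of a
  Poisson variable with mean \<open>\<mu> = c d\<close>, and Chernoff's bound controls its upper tail. Writing the
  threshold as \<open>r \<mu> / ln r\<close> with \<open>r = (2 + \<epsilon>) ln n / \<mu>\<close>, the exponent of this bound is
  \<open>- (1 - o(1)) r \<mu> = - (1 - o(1)) (2 + \<epsilon>) ln n\<close> as \<open>r\<close> tends to infinity, so that the tail is
  eventually at most \<open>1 / n\<^sup>2\<close>, and a union bound over the bins concludes.
\<close>

lemma smallo_imp_filterlim_divide_at_top:
  fixes f g :: "'a \<Rightarrow> real"
  assumes "f \<in> o[F](g)" "\<forall>\<^sub>F x in F. 0 < f x" "\<forall>\<^sub>F x in F. 0 < g x"
  shows "filterlim (\<lambda>x. g x / f x) at_top F"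
proof -
  have "((\<lambda>x. f x / g x) \<longlongrightarrow> 0) F"
    using assms(1) by (rule smalloD_tendsto)
  moreover have "\<forall>\<^sub>F x in F. 0 < f x / g x"
    using assms(2,3) by eventually_elim simp
  ultimately show ?thesis
    using filterlim_inverse_at_top by fastforce
qed

lemma emeasure_bind_pmf_le_emeasure:
  assumes "\<And>x y. x \<in> set_pmf p \<Longrightarrow> y \<in> set_pmf (f x) \<Longrightarrow> y \<in> B \<Longrightarrow> x \<in> A"
  shows "emeasure (bind_pmf p f) B \<le> emeasure p A"
proof -
  have "emeasure (f x) B \<le> indicator A x" if "x \<in> set_pmf p" for x
  proof (cases "x \<in> A")
    case True
    then show ?thesis by (simp add: measure_pmf.emeasure_le_1)
  next
    case False
    then have "set_pmf (f x) \<inter> B = {}" using assms that by blast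
    then show ?thesis
      by (simp add: measure_pmf.emeasure_eq_measure measure_pmf_zero_iff[THEN iffD2])
  qed
  then have "emeasure (bind_pmf p f) B \<le> (\<integral>\<^sup>+x. indicator A x \<partial>p)"
    unfolding emeasure_bind_pmf by (intro nn_integral_mono_AE AE_pmfI)
  then show ?thesis by simp
qed

lemma emeasure_mem_replicate_pmf_le:
  "emeasure (replicate_pmf k p) {xs. a \<in> set xs} \<le> of_nat k * ennreal (pmf p a)"
proof (induction k)
  case 0
  show ?case by simp
next
  case (Suc k)
  have "emeasure (replicate_pmf (Suc k) p) {xs. a \<in> set xs}
      = (\<integral>\<^sup>+x. \<integral>\<^sup>+xs. indicator {xs. a \<in> set xs} (x # xs) \<partial>replicate_pmf k p \<partial>p)"
    by (simp add: indicator_def)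
  also have "\<dots> \<le> (\<integral>\<^sup>+x. \<integral>\<^sup>+xs. indicator {a} x + indicator {xs. a \<in> set xs} xs
      \<partial>replicate_pmf k p \<partial>p)"
    by (intro nn_integral_mono) (auto simp: indicator_def)
  also have "\<dots> = ennreal (pmf p a) + emeasure (replicate_pmf k p) {xs. a \<in> set xs}"
    by (simp add: nn_integral_add emeasure_pmf_single)
  also have "\<dots> \<le> of_nat (Suc k) * ennreal (pmf p a)"
    using Suc.IH by (simp add: distrib_right)
  finally show ?case .
qed

lemma nn_integral_exp_increment_le:
  fixes X :: "'a \<Rightarrow> real" and q :: "'a pmf"
  assumes bounded: "\<And>y. y \<in> set_pmf q \<Longrightarrow> X y \<le> k + 1"
    and prob: "emeasure q {y. k < X y} \<le> ennreal p" and "0 \<le> p" "0 \<le> t"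
  shows "(\<integral>\<^sup>+y. ennreal (exp (t * X y)) \<partial>q)
      \<le> ennreal (exp (p * (exp t - 1))) * ennreal (exp (t * k))"
proof -
  have "exp (t * X y) \<le> exp (t * k) * (1 + (exp t - 1) * indicator {y. k < X y} y)"
    if "y \<in> set_pmf q" for y
  proof (cases "k < X y")
    case True
    have "exp (t * X y) \<le> exp (t * (k + 1))"
      using bounded[OF that] \<open>0 \<le> t\<close> by (simp add: mult_left_mono)
    with True show ?thesis by (simp add: distrib_left exp_add)
  next
    case False
    with \<open>0 \<le> t\<close> show ?thesis by (simp add: mult_left_mono)
  qed
  then have "(\<integral>\<^sup>+y. ennreal (exp (t * X y)) \<partial>q)
      \<le> (\<integral>\<^sup>+y. ennreal (exp (t * k) * (1 + (exp t - 1) * indicator {y. k < X y} y)) \<partial>q)"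
    by (intro nn_integral_mono_AE AE_pmfI ennreal_leI)
  also have "\<dots> = (\<integral>\<^sup>+y. ennreal (exp (t * k)) * (1 + ennreal (exp t - 1) * indicator {y. k < X y} y)
      \<partial>q)"
    using \<open>0 \<le> t\<close> by (intro nn_integral_cong) (auto simp: indicator_def ennreal_mult)
  also have "\<dots> = ennreal (exp (t * k)) * (1 + ennreal (exp t - 1) * emeasure q {y. k < X y})"
    by (simp add: nn_integral_cmult nn_integral_add)
  also have "\<dots> \<le> ennreal (exp (t * k)) * (1 + ennreal (exp t - 1) * ennreal p)"
    by (intro mult_left_mono add_left_mono prob) auto
  also have "\<dots> = ennreal (exp (t * k) * (1 + p * (exp t - 1)))"
    using \<open>0 \<le> p\<close> \<open>0 \<le> t\<close> by (simp add: ennreal_mult mult.commute)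
  also have "\<dots> \<le> ennreal (exp (t * k) * exp (p * (exp t - 1)))"
    by (intro ennreal_leI mult_left_mono exp_ge_add_one_self) auto
  finally show ?thesis
    by (simp add: ennreal_mult mult.commute)
qed

definition poisson_rate :: "real \<Rightarrow> real \<Rightarrow> real" where
  "poisson_rate \<mu> x = x * ln (x / \<mu>) - x + \<mu>"

lemma prob_ge_le_exp_poisson_rate:
  fixes X :: "'a \<Rightarrow> real" and p :: "'a pmf"
  assumes mgf: "\<And>t. 0 \<le> t \<Longrightarrow> (\<integral>\<^sup>+y. ennreal (exp (t * X y)) \<partial>p)
      \<le> ennreal (exp (\<mu> * (exp t - 1)))"
    and "0 < \<mu>" "\<mu> < x"
  shows "measure_pmf.prob p {y. x \<le> X y} \<le> exp (- poisson_rate \<mu> x)"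
proof -
  define t where "t = ln (x / \<mu>)"
  have "0 < t" and exp_t: "exp t = x / \<mu>"
    using \<open>0 < \<mu>\<close> \<open>\<mu> < x\<close> by (simp_all add: t_def)
  have "emeasure p {y. x \<le> X y} \<le> ennreal (exp (- t * x)) * (\<integral>\<^sup>+y. ennreal (exp (t * X y)) \<partial>p)"
    using Chernoff_ineq_nn_integral_ge[OF \<open>0 < t\<close>, of UNIV "measure_pmf p" X x] by simp
  also have "\<dots> \<le> ennreal (exp (- t * x)) * ennreal (exp (\<mu> * (exp t - 1)))"
    using \<open>0 < t\<close> by (intro mult_left_mono mgf) auto
  also have "\<dots> = ennreal (exp (- t * x + \<mu> * (exp t - 1)))"
    by (simp add: exp_add[symmetric] ennreal_mult[symmetric])
  also have "- t * x + \<mu> * (exp t - 1) = - poisson_rate \<mu> x"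
    unfolding exp_t using \<open>0 < \<mu>\<close> by (simp add: poisson_rate_def t_def field_simps)
  finally show ?thesis
    by (simp add: measure_pmf.emeasure_eq_measure)
qed

lemma poisson_rate_mult_div_ln:
  assumes "1 < r" "0 < \<mu>"
  shows "poisson_rate \<mu> (r * \<mu> / ln r) = r * \<mu> * (1 - (1 + ln (ln r)) / ln r) + \<mu>"
proof -
  have "0 < ln r" using \<open>1 < r\<close> by simp
  then have ln_ratio: "ln (r * \<mu> / ln r / \<mu>) = ln r - ln (ln r)"
    using assms by (simp add: ln_div)
  show ?thesis
    unfolding poisson_rate_def ln_ratio using \<open>0 < ln r\<close> by (simp add: field_simps)
qed

lemma eventually_poisson_rate_ge:
  assumes "0 < \<delta>"
  shows "\<forall>\<^sub>F r in at_top. \<forall>\<mu>>0. \<mu> < r * \<mu> / ln r \<and>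
           (1 - \<delta>) * (r * \<mu>) \<le> poisson_rate \<mu> (r * \<mu> / ln r)"
proof -
  have "((\<lambda>r::real. (1 + ln (ln r)) / ln r) \<longlongrightarrow> 0) at_top"
    by real_asymp
  from order_tendstoD(2)[OF this assms]
  show ?thesis using eventually_gt_at_top[of 1]
  proof eventually_elim
    case (elim r)
    show ?case
    proof (intro allI impI conjI)
      fix \<mu> :: real
      assume "0 < \<mu>"
      show "\<mu> < r * \<mu> / ln r"
        using elim(2) \<open>0 < \<mu>\<close> ln_less_self[of r] by (simp add: field_simps)
      have "(1 - \<delta>) * (r * \<mu>) \<le> (1 - (1 + ln (ln r)) / ln r) * (r * \<mu>)"
        using elim \<open>0 < \<mu>\<close> by (intro mult_right_mono) auto
      also have "\<dots> \<le> poisson_rate \<mu> (r * \<mu> / ln r)"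
        unfolding poisson_rate_mult_div_ln[OF elim(2) \<open>0 < \<mu>\<close>]
        using \<open>0 < \<mu>\<close> by (simp add: mult.commute)
      finally show "(1 - \<delta>) * (r * \<mu>) \<le> poisson_rate \<mu> (r * \<mu> / ln r)" .
    qed
  qed
qed

lemma smallo_imp_eventually_poisson_rate_ge:
  fixes \<mu> a :: "'a \<Rightarrow> real"
  assumes "\<mu> \<in> o[F](a)" "\<forall>\<^sub>F z in F. 0 < \<mu> z" "\<forall>\<^sub>F z in F. 0 < a z" "0 < \<delta>"
  shows "\<forall>\<^sub>F z in F. \<mu> z < a z / ln (a z / \<mu> z) \<and>
           (1 - \<delta>) * a z \<le> poisson_rate (\<mu> z) (a z / ln (a z / \<mu> z))"
  using eventually_compose_filterlim[OF eventually_poisson_rate_ge[OF assms(4)]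
      smallo_imp_filterlim_divide_at_top[OF assms(1-3)]] assms(2)
proof eventually_elim
  case (elim z)
  have "a z / \<mu> z * \<mu> z = a z" using elim(2) by simp
  with elim show ?case by metis
qed

lemma size_choices: "S \<in> set_pmf (choices n d) \<Longrightarrow> size S = d"
  by (auto simp: choices_def set_replicate_pmf)

lemma emeasure_mem_choices_le:
  assumes "1 \<le> n"
  shows "emeasure (choices n d) {S. i \<in># S} \<le> ennreal (real d / real n)"
proof -
  have "emeasure (choices n d) {S. i \<in># S} \<le> of_nat d * ennreal (pmf (pmf_of_set {1..n}) i)"
    using emeasure_mem_replicate_pmf_le by (simp add: choices_def vimage_def)
  also have "\<dots> \<le> of_nat d * ennreal (1 / real n)"
    using assms by (intro mult_left_mono ennreal_leI) (auto simp: indicator_def)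
  also have "\<dots> = ennreal (real d / real n)"
    by (simp add: ennreal_of_nat_eq_real_of_nat ennreal_mult[symmetric])
  finally show ?thesis .
qed

lemma fullest_subset: "fullest L S \<subseteq> set_mset S"
  by (auto simp: fullest_def)

lemma fullest_nonempty:
  assumes "S \<noteq> {#}"
  shows "fullest L S \<noteq> {}"
proof -
  obtain M where "M \<in># S" "L M = Max (L ` set_mset S)"
    using assms by (auto intro: obtains_MAX[of "set_mset S" L])
  then have "M \<in> fullest L S" by (simp add: fullest_def)
  then show ?thesis by blast
qed

lemma set_pmf_of_set_fullest_subset:
  assumes "S \<noteq> {#}"
  shows "set_pmf (pmf_of_set (fullest L S)) \<subseteq> set_mset S"
proof -
  have "finite (fullest L S)"
    using fullest_subset by (rule finite_subset) simp
  then show ?thesis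
    by (simp add: set_pmf_of_set fullest_nonempty[OF assms] fullest_subset)
qed

lemma greedy_step_load_le: "L' \<in> set_pmf (greedy_step n d L) \<Longrightarrow> L' i \<le> L i + 1"
  by (auto simp: greedy_step_def)

lemma emeasure_greedy_step_load_less_le:
  assumes "1 \<le> n" "1 \<le> d"
  shows "emeasure (greedy_step n d L) {L'. L i < L' i} \<le> ennreal (real d / real n)"
proof -
  have "emeasure (greedy_step n d L) {L'. L i < L' i} \<le> emeasure (choices n d) {S. i \<in># S}"
    unfolding greedy_step_def
  proof (rule emeasure_bind_pmf_le_emeasure)
    fix S L'
    assume S: "S \<in> set_pmf (choices n d)" and less: "L' \<in> {L'. L i < L' i}"
      and placed: "L' \<in> set_pmf (bind_pmf (pmf_of_set (fullest L S))
        (\<lambda>M. return_pmf (L(M := L M + 1))))"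
    from S have "S \<noteq> {#}" using size_choices assms(2) by fastforce
    moreover have "i \<in> set_pmf (pmf_of_set (fullest L S))"
      using placed less by (auto split: if_splits)
    ultimately show "S \<in> {S. i \<in># S}" using set_pmf_of_set_fullest_subset by blast
  qed
  then show ?thesis using emeasure_mem_choices_le[OF assms(1)] by (rule order_trans)
qed

lemma nn_integral_exp_load_greedy_le:
  assumes "1 \<le> n" "1 \<le> d" "0 \<le> t"
  shows "(\<integral>\<^sup>+L. ennreal (exp (t * real (L i))) \<partial>greedy m n d)
      \<le> ennreal (exp (real m * real d / real n * (exp t - 1)))"
proof (induction m)
  case 0
  show ?case by simp
next
  case (Suc m)
  define b where "b = real d / real n * (exp t - 1)"
  have step: "(\<integral>\<^sup>+L'. ennreal (exp (t * real (L' i))) \<partial>greedy_step n d L)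
      \<le> ennreal (exp b) * ennreal (exp (t * real (L i)))" for L
    unfolding b_def
  proof (rule nn_integral_exp_increment_le)
    show "real (L' i) \<le> real (L i) + 1" if "L' \<in> set_pmf (greedy_step n d L)" for L'
      using greedy_step_load_le[OF that, of i] by linarith
  qed (use assms emeasure_greedy_step_load_less_le in auto)
  have "(\<integral>\<^sup>+L. ennreal (exp (t * real (L i))) \<partial>greedy (Suc m) n d)
      = (\<integral>\<^sup>+L. \<integral>\<^sup>+L'. ennreal (exp (t * real (L' i))) \<partial>greedy_step n d L \<partial>greedy m n d)"
    by simp
  also have "\<dots> \<le> (\<integral>\<^sup>+L. ennreal (exp b) * ennreal (exp (t * real (L i))) \<partial>greedy m n d)"
    by (intro nn_integral_mono step)
  also have "\<dots> = ennreal (exp b) * (\<integral>\<^sup>+L. ennreal (exp (t * real (L i))) \<partial>greedy m n d)"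
    by (simp add: nn_integral_cmult)
  also have "\<dots> \<le> ennreal (exp b) * ennreal (exp (real m * real d / real n * (exp t - 1)))"
    by (intro mult_left_mono Suc.IH) auto
  also have "\<dots> = ennreal (exp (real (Suc m) * real d / real n * (exp t - 1)))"
    by (simp add: b_def ennreal_mult[symmetric] exp_add[symmetric] algebra_simps add_divide_distrib)
  finally show ?case .
qed

lemma prob_load_ge_le:
  assumes "1 \<le> n" "1 \<le> d"
    and "real m * real d / real n = \<mu>" "0 < \<mu>" "\<mu> < x"
  shows "measure_pmf.prob (greedy m n d) {L. x \<le> real (L i)} \<le> exp (- poisson_rate \<mu> x)"
  using nn_integral_exp_load_greedy_le[OF assms(1,2), where m = m] assms(3-)
  by (intro prob_ge_le_exp_poisson_rate) auto

lemma le_max_load_iff: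
  assumes "1 \<le> n"
  shows "x \<le> real (max_load n L) \<longleftrightarrow> (\<exists>i\<in>{1..n}. x \<le> real (L i))"
proof -
  have "real (max_load n L) = Max ((\<lambda>i. real (L i)) ` {1..n})"
    using assms by (simp add: max_load_def mono_Max_commute[of real] monoI image_image)
  then show ?thesis using assms by (simp add: Max_ge_iff)
qed

lemma prob_max_load_less_ge:
  assumes "1 \<le> n" "1 \<le> d"
    and "real m * real d / real n = \<mu>" "0 < \<mu>" "\<mu> < x"
  shows "1 - real n * exp (- poisson_rate \<mu> x)
      \<le> measure_pmf.prob (greedy m n d) {L. real (max_load n L) < x}"
proof -
  let ?P = "measure_pmf.prob (greedy m n d)"
  have "?P {L. x \<le> real (max_load n L)} = ?P (\<Union>i\<in>{1..n}. {L. x \<le> real (L i)})"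
    using le_max_load_iff[OF \<open>1 \<le> n\<close>] by (intro arg_cong[of _ _ ?P]) auto
  also have "\<dots> \<le> (\<Sum>i\<in>{1..n}. ?P {L. x \<le> real (L i)})"
    by (intro measure_pmf.finite_measure_subadditive_finite) auto
  also have "\<dots> \<le> (\<Sum>i\<in>{1..n}. exp (- poisson_rate \<mu> x))"
    by (intro sum_mono prob_load_ge_le assms)
  finally have "?P {L. x \<le> real (max_load n L)} \<le> real n * exp (- poisson_rate \<mu> x)" by simp
  moreover have "?P {L. real (max_load n L) < x} = 1 - ?P {L. x \<le> real (max_load n L)}"
    using measure_pmf.prob_neg[of "greedy m n d" "\<lambda>L. x \<le> real (max_load n L)"]
    by (simp add: not_le)
  ultimately show ?thesis by simp
qed

corollary prob_max_load_less_ge_one_minus_inverse: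
  assumes "1 \<le> n" "1 \<le> d"
    and "real m * real d / real n = \<mu>" "0 < \<mu>" "\<mu> < x"
    and "2 * ln (real n) \<le> poisson_rate \<mu> x"
  shows "1 - 1 / real n \<le> measure_pmf.prob (greedy m n d) {L. real (max_load n L) < x}"
proof -
  have "exp (- poisson_rate \<mu> x) \<le> exp (- (2 * ln (real n)))"
    using assms(6) by simp
  also have "\<dots> = 1 / (real n)\<^sup>2"
    using \<open>1 \<le> n\<close> by (simp add: exp_minus exp_double inverse_eq_divide)
  finally have "real n * exp (- poisson_rate \<mu> x) \<le> 1 / real n"
    using \<open>1 \<le> n\<close> by (simp add: power2_eq_square field_simps)
  then show ?thesis
    using prob_max_load_less_ge[OF assms(1-5)] by linarith
qed

theorem theorem3p4:
  fixes c :: "nat \<Rightarrow> real" and d :: "nat \<Rightarrow> nat" and \<epsilon> :: real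
  assumes "\<And>n. n \<ge> 1 \<Longrightarrow> c n > 0"
    and "\<And>n. n \<ge> 1 \<Longrightarrow> d n \<ge> 1"
    and "(\<lambda>n. c n * real (d n)) \<in> o(\<lambda>n. ln (real n))"
    and "\<epsilon> > 0"
  shows "\<forall>\<^sub>F n in sequentially. \<forall>m::nat. real m = c n * real n \<longrightarrow>
           measure_pmf.prob (greedy m n (d n))
             {L. real (max_load n L) <
                 (2 + \<epsilon>) * ln (real n) /
                 (ln (2 + \<epsilon>) + ln (ln (real n)) - ln (c n) - ln (real (d n)))}
           \<ge> 1 - 1 / real n"
proof -
  define \<mu> a where "\<mu> n = c n * real (d n)" and "a n = (2 + \<epsilon>) * ln (real n)" for n
  have \<mu>_pos: "0 < \<mu> n" if "1 \<le> n" for n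
    using assms(1,2)[OF that] by (simp add: \<mu>_def)
  have a_pos: "0 < a n" if "2 \<le> n" for n
    using assms(4) that by (simp add: a_def)
  have "\<mu> \<in> o(a)" and "0 < \<epsilon> / (2 + \<epsilon>)"
    using assms(3,4) by (simp_all add: \<mu>_def[abs_def] a_def[abs_def])
  then have "\<forall>\<^sub>F n in sequentially. \<mu> n < a n / ln (a n / \<mu> n) \<and>
      (1 - \<epsilon> / (2 + \<epsilon>)) * a n \<le> poisson_rate (\<mu> n) (a n / ln (a n / \<mu> n))"
    using \<mu>_pos a_pos
    by (intro smallo_imp_eventually_poisson_rate_ge eventually_sequentiallyI[of 2]) auto
  then show ?thesis using eventually_ge_at_top[of 2]
  proof eventually_elim
    case (elim n)
    then have n: "1 \<le> n" "0 < ln (real n)" by auto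
    have ln_ratio: "ln (2 + \<epsilon>) + ln (ln (real n)) - ln (c n) - ln (real (d n)) = ln (a n / \<mu> n)"
      using assms(1,2)[OF n(1)] assms(4) n(2) by (simp add: a_def \<mu>_def ln_mult ln_div)
    have "(1 - \<epsilon> / (2 + \<epsilon>)) * a n = 2 * ln (real n)"
      using assms(4) by (simp add: a_def field_simps)
    with elim(1) have "2 * ln (real n) \<le> poisson_rate (\<mu> n) (a n / ln (a n / \<mu> n))"
      by simp
    moreover have "real m * real (d n) / real n = \<mu> n" if "real m = c n * real n" for m
      using n(1) that by (simp add: \<mu>_def)
    ultimately show ?case
      unfolding ln_ratio a_def[symmetric] using elim(1) n(1) \<mu>_pos assms(2)
      by (blast intro: prob_max_load_less_ge_one_minus_inverse)
  qed
qed

end
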